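(* Let $G$ be a graph on the vertex set $\omega_1$. If $G$ is $n$-smooth for some $n\in\omega$, then $G$ is complete or empty.
   Context: Graphs are simple and undirected. For a graph $G$ with vertex set $\omega_1$ and $H\subset\omega_1$, $G[H]$ denotes the subgraph of $G$ induced on $H$. A graph $G$ on $\omega_1$ is called $\kappa$-smooth if for each uncountable $W\subset\omega_1$ there is some $W'\subset W$ with $|W'|\le\kappa$ such that $G$ is isomorphic to $G[W\setminus W']$. A graph is complete if every pair of distinct vertices is an edge, and empty if it has no edges. *)

theory Defs
  imports "HOL-Library.Countable_Set"
begin

unbundle cardinal_syntax

(* The carrier of the library's well-order for the cardinal successor of omega.  The
   element type "nat set" only provides room for the ordinals; it plays no other role. *)
definition omega1 :: "nat set set" where
  "omega1 = Field (cardSuc natLeq)"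

record 'a graph =
  verts :: "'a set"
  edges :: "'a rel"

definition simple_graph :: "'a graph \<Rightarrow> bool" where
  "simple_graph G \<longleftrightarrow> edges G \<subseteq> verts G \<times> verts G \<and> sym (edges G) \<and> irrefl (edges G)"

definition induced :: "'a graph \<Rightarrow> 'a set \<Rightarrow> 'a graph" where
  "induced G H = \<lparr>verts = verts G \<inter> H, edges = Restr (edges G) H\<rparr>"

definition isomorphic :: "'a graph \<Rightarrow> 'b graph \<Rightarrow> bool" where
  "isomorphic G G' \<longleftrightarrow> (\<exists>f. bij_betw f (verts G) (verts G') \<and>
     (\<forall>x\<in>verts G. \<forall>y\<in>verts G. (x, y) \<in> edges G \<longleftrightarrow> (f x, f y) \<in> edges G'))"

(* The cardinal \<kappa> is given as an order relation, as usual for \<le>o; for a natural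
   number n take |{..<n}|. *)
definition smooth :: "'k rel \<Rightarrow> 'a graph \<Rightarrow> bool" where
  "smooth \<kappa> G \<longleftrightarrow> (\<forall>W \<subseteq> verts G. uncountable W \<longrightarrow>
     (\<exists>W' \<subseteq> W. |W'| \<le>o \<kappa> \<and> isomorphic G (induced G (W - W'))))"

definition complete_graph :: "'a graph \<Rightarrow> bool" where
  "complete_graph G \<longleftrightarrow> (\<forall>x\<in>verts G. \<forall>y\<in>verts G. x \<noteq> y \<longrightarrow> (x, y) \<in> edges G)"

definition empty_graph :: "'a graph \<Rightarrow> bool" where
  "empty_graph G \<longleftrightarrow> edges G = {}"

lemma countable_iff_ordLeq_natLeq: "countable A \<longleftrightarrow> |A| \<le>o natLeq"
proof -
  have "countable A \<longleftrightarrow> |A| \<le>o |UNIV :: nat set|"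
    unfolding countable_def card_of_ordLeq[symmetric] by simp
  then show ?thesis
    using card_of_nat ordIso_symmetric ordLeq_ordIso_trans by blast
qed

lemma omega1_ordIso: "|omega1| =o cardSuc natLeq"
  unfolding omega1_def
  by (simp add: card_of_Field_ordIso cardSuc_Card_order natLeq_Card_order)

lemma uncountable_iff_omega1_ordLeq: "uncountable A \<longleftrightarrow> |omega1| \<le>o |A|"
proof -
  have "uncountable A \<longleftrightarrow> natLeq <o |A|"
    unfolding countable_iff_ordLeq_natLeq
    by (rule not_ordLeq_iff_ordLess[OF natLeq_Well_order card_of_Well_order])
  also have "\<dots> \<longleftrightarrow> cardSuc natLeq \<le>o |A|"
    by (rule cardSuc_ordLess_ordLeq[OF natLeq_Card_order card_of_Card_order])
  also have "\<dots> \<longleftrightarrow> |omega1| \<le>o |A|"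
    using omega1_ordIso ordIso_ordLeq_trans ordIso_symmetric by blast
  finally show ?thesis .
qed

lemma card_of_ordLeq_lessThan: "|A| \<le>o |{..<n::nat}| \<longleftrightarrow> finite A \<and> card A \<le> n"
proof -
  have "|A| \<le>o |{..<n}| \<longleftrightarrow> card A \<le> card {..<n}" if "finite A"
    using that unfolding card_of_ordLeq[symmetric] by (metis card_inj_on_le card_le_inj finite_lessThan)
  then show ?thesis
    using card_of_ordLeq_finite by force
qed

end

(* Both the edges and the non-edges of a smooth graph obey a dichotomy: if one vertex has countably
   many neighbours, there are no edges at all.  Indeed, let D be the set of vertices of countable
   degree.  If D is uncountable, it contains an uncountable independent set, and G embeds into it.
   If D is countable, G is isomorphic to V - D minus finitely many vertices, where every degree is
   uncountable.  On the other hand, take n + 1 vertices together with uncountably many vertices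
   that are all joined to them in the same way: after deleting n vertices, one of the n + 1
   remains, and it has finitely many neighbours or finitely many non-neighbours. *)
theory Submission
  imports Defs
begin

text \<open>Zorn's lemma gives a maximal independent subset \<open>A\<close> of \<open>D\<close>. By
  maximality \<open>D\<close> is covered by \<open>A\<close> and the neighbourhoods in
  \<open>D\<close> of its points, each countable; a countable \<open>A\<close> would make
  \<open>D\<close> countable.\<close>

lemma uncountable_independent_subset:
  assumes "symp E" and "uncountable D"
    and deg: "\<And>v. v \<in> D \<Longrightarrow> countable {y \<in> D. E v y}"
  obtains A where "A \<subseteq> D" "uncountable A" "pairwise (\<lambda>x y. \<not> E x y) A"
proof -
  let ?I = "{A. A \<subseteq> D \<and> pairwise (\<lambda>x y. \<not> E x y) A}"
  have "\<exists>M\<in>?I. \<forall>X\<in>?I. M \<subseteq> X \<longrightarrow> X = M"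
  proof (rule subset_Zorn_nonempty)
    show "?I \<noteq> {}"
      by (auto simp: pairwise_def)
    fix \<C> assume chain: "subset.chain ?I \<C>"
    have "\<not> E x y" if xy: "x \<in> \<Union>\<C>" "y \<in> \<Union>\<C>" "x \<noteq> y" for x y
    proof -
      obtain X Y where "X \<in> \<C>" "x \<in> X" "Y \<in> \<C>" "y \<in> Y"
        using xy by blast
      moreover from this have "X \<subseteq> Y \<or> Y \<subseteq> X"
        using chain unfolding subset_chain_def by blast
      moreover have "\<C> \<subseteq> ?I"
        using chain unfolding subset_chain_def by blast
      ultimately show ?thesis
        using \<open>x \<noteq> y\<close> unfolding pairwise_def by blast
    qed
    moreover have "\<Union>\<C> \<subseteq> D"
      using chain unfolding subset_chain_def by blast
    ultimately show "\<Union>\<C> \<in> ?I"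
      by (simp add: pairwise_def)
  qed
  then obtain A where "A \<in> ?I" and max: "\<forall>X\<in>?I. A \<subseteq> X \<longrightarrow> X = A"
    by (rule bexE)
  then have A: "A \<subseteq> D" "pairwise (\<lambda>x y. \<not> E x y) A"
    by simp_all
  have "D \<subseteq> A \<union> (\<Union>a\<in>A. {y \<in> D. E a y})"
  proof
    fix d assume "d \<in> D"
    show "d \<in> A \<union> (\<Union>a\<in>A. {y \<in> D. E a y})"
    proof (rule ccontr)
      \<comment> \<open>A point outside the cover could be added to \<open>A\<close>, against
        maximality.\<close>
      assume d: "d \<notin> A \<union> (\<Union>a\<in>A. {y \<in> D. E a y})"
      then have "\<not> E a d \<and> \<not> E d a" if "a \<in> A" for a
        using that \<open>d \<in> D\<close> \<open>symp E\<close> by (auto dest: sympD)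
      then have "insert d A \<in> ?I"
        using A \<open>d \<in> D\<close> by (auto simp: pairwise_insert)
      then have "insert d A = A"
        using max by (metis subset_insertI)
      with d show False
        by blast
    qed
  qed
  moreover have "countable (A \<union> (\<Union>a\<in>A. {y \<in> D. E a y}))" if "countable A"
    using that deg A(1) by blast
  ultimately have "uncountable A"
    using \<open>uncountable D\<close> countable_subset by blast
  with A that show ?thesis
    by blast
qed

text \<open>Adjacency is a predicate here, so that passing to the complement is just negating
  \<open>E\<close>, with the same isomorphisms \<open>f\<close>.\<close>

definition rel_iso_on :: "('a \<Rightarrow> 'a \<Rightarrow> bool) \<Rightarrow> 'a set \<Rightarrow> 'a set \<Rightarrow> ('a \<Rightarrow> 'a) \<Rightarrow> bool" where
  "rel_iso_on E V W f \<longleftrightarrow> bij_betw f V W \<and> (\<forall>x\<in>V. \<forall>y\<in>V. E x y \<longleftrightarrow> E (f x) (f y))"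

lemma rel_iso_on_image_neighbours:
  assumes "rel_iso_on E V W f" "v \<in> V"
  shows "f ` {y \<in> V. E v y} = {z \<in> W. E (f v) z}"
  using assms unfolding rel_iso_on_def bij_betw_def by blast

lemma rel_iso_on_countable_neighbours_iff:
  assumes "rel_iso_on E V W f" "v \<in> V"
  shows "countable {y \<in> V. E v y} \<longleftrightarrow> countable {z \<in> W. E (f v) z}"
proof -
  have "inj_on f {y \<in> V. E v y}"
    using assms(1) unfolding rel_iso_on_def bij_betw_def by (auto intro: inj_on_subset)
  then have "countable (f ` {y \<in> V. E v y}) \<longleftrightarrow> countable {y \<in> V. E v y}"
    by (rule countable_image_inj_eq)
  then show ?thesis
    unfolding rel_iso_on_image_neighbours[OF assms] by (rule sym)
qed

lemma rel_iso_on_not: "rel_iso_on (\<lambda>x y. \<not> E x y) V W f \<longleftrightarrow> rel_iso_on E V W f"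
  unfolding rel_iso_on_def by blast

text \<open>Stated for any symmetric relation, to serve for both edges and non-edges. Non-edges may
  relate a vertex to itself, so the conclusion speaks of distinct vertices only.\<close>

lemma independent_if_countable_neighbours:
  assumes "symp E" and "uncountable V"
    and smooth: "\<And>W. W \<subseteq> V \<Longrightarrow> uncountable W \<Longrightarrow>
      \<exists>W'. finite W' \<and> (\<exists>f. rel_iso_on E V (W - W') f)"
    and v: "v \<in> V" "countable {y \<in> V. E v y}"
  shows "pairwise (\<lambda>x y. \<not> E x y) V"
proof -
  define D where "D = {v \<in> V. countable {y \<in> V. E v y}}"
  have "D \<subseteq> V"
    unfolding D_def by blast
  have "uncountable D"
  proof
    assume "countable D"
    then have "uncountable (V - D)"
      using \<open>uncountable V\<close> by (rule uncountable_minus_countable[rotated])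
    then obtain W' f where W': "finite W'" and f: "rel_iso_on E V (V - D - W') f"
      using smooth[of "V - D"] by blast
    have "countable {z \<in> V - D - W'. E (f v) z}"
      using rel_iso_on_countable_neighbours_iff[OF f] v by blast
    \<comment> \<open>Putting the countable sets \<open>D\<close> and \<open>W'\<close> back keeps
      the neighbourhood of \<open>f v\<close> countable, so \<open>f v\<close> would belong to
      \<open>D\<close>, although \<open>f\<close> maps into its complement.\<close>
    then have "countable ({z \<in> V - D - W'. E (f v) z} \<union> D \<union> W')"
      using W' \<open>countable D\<close> by (simp add: countable_finite)
    then have "countable {z \<in> V. E (f v) z}"
      by (rule countable_subset[rotated]) blast
    moreover have "f v \<in> V - D"
      using f v unfolding rel_iso_on_def bij_betw_def by blast
    ultimately show False
      unfolding D_def by blast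
  qed
  moreover have "countable {y \<in> D. E v y}" if "v \<in> D" for v
    using that unfolding D_def by (auto intro: countable_subset[rotated])
  ultimately obtain A where A: "A \<subseteq> D" "uncountable A" "pairwise (\<lambda>x y. \<not> E x y) A"
    using uncountable_independent_subset[OF \<open>symp E\<close>] by blast
  then obtain W' f where f: "rel_iso_on E V (A - W') f"
    using smooth[OF subset_trans[OF A(1) \<open>D \<subseteq> V\<close>] A(2)] by (elim exE conjE)
  show ?thesis
  proof (rule pairwiseI)
    fix x y assume xy: "x \<in> V" "y \<in> V" "x \<noteq> y"
    then have "f x \<in> A" "f y \<in> A" "f x \<noteq> f y"
      using f unfolding rel_iso_on_def bij_betw_def inj_on_def by blast+
    then have "\<not> E (f x) (f y)"
      using A(3) unfolding pairwise_def by blast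
    then show "\<not> E x y"
      using f xy unfolding rel_iso_on_def by blast
  qed
qed

text \<open>Pigeonhole: the classes given by the traces \<open>T\<close> on \<open>S\<close> cover
  \<open>V\<close>, and the finite set \<open>S\<close> has only finitely many subsets.\<close>

lemma uncountable_same_neighbours:
  assumes "finite S" and "uncountable V"
  obtains T where "uncountable {x \<in> V. {s \<in> S. E s x} = T}"
proof (rule ccontr)
  assume "\<not> thesis"
  with that have "countable {x \<in> V. {s \<in> S. E s x} = T}" for T
    by metis
  moreover have "countable (Pow S)"
    using \<open>finite S\<close> by (simp add: countable_finite)
  ultimately have "countable (\<Union>T\<in>Pow S. {x \<in> V. {s \<in> S. E s x} = T})"
    by (intro countable_UN)
  moreover have "V \<subseteq> (\<Union>T\<in>Pow S. {x \<in> V. {s \<in> S. E s x} = T})"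
  proof
    fix x assume "x \<in> V"
    then show "x \<in> (\<Union>T\<in>Pow S. {x \<in> V. {s \<in> S. E s x} = T})"
      by (intro UN_I[of "{s \<in> S. E s x}"]) simp_all
  qed
  ultimately have "countable V"
    by (rule countable_subset[rotated])
  with \<open>uncountable V\<close> show False ..
qed

lemma finitely_smooth_cases:
  fixes n :: nat
  assumes "symp E" and "uncountable V"
    and smooth: "\<And>W. W \<subseteq> V \<Longrightarrow> uncountable W \<Longrightarrow>
      \<exists>W'. finite W' \<and> card W' \<le> n \<and> (\<exists>f. rel_iso_on E V (W - W') f)"
  shows "pairwise E V \<or> pairwise (\<lambda>x y. \<not> E x y) V"
proof -
  have "infinite V"
    using \<open>uncountable V\<close> countable_finite by blast
  then obtain S where S: "S \<subseteq> V" "finite S" "card S = Suc n"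
    using infinite_arbitrarily_large by blast
  obtain T where T: "uncountable {x \<in> V. {s \<in> S. E s x} = T}"
    using uncountable_same_neighbours[OF S(2) \<open>uncountable V\<close>] .
  define W where "W = S \<union> {x \<in> V. {s \<in> S. E s x} = T}"
  have "W \<subseteq> V" "uncountable W"
    using S(1) T countable_subset[OF Un_upper2] unfolding W_def by blast+
  then obtain W' f where W': "finite W'" "card W' \<le> n" and f: "rel_iso_on E V (W - W') f"
    using smooth by meson
  \<comment> \<open>Here \<open>n + 1\<close> elements are needed: at most \<open>n\<close> vertices
    are deleted, so some \<open>s\<close> in \<open>S\<close> survives.\<close>
  have "\<not> S \<subseteq> W'"
    using S(3) W' card_mono[of W' S] by auto
  then obtain s where s: "s \<in> S" "s \<in> W - W'"
    unfolding W_def by blast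
  \<comment> \<open>The degree of \<open>s\<close> is only controlled inside \<open>W - W'\<close>;
    pulling \<open>s\<close> back along \<open>f\<close> gives a vertex \<open>v\<close> with the
    same behaviour in all of \<open>V\<close>.\<close>
  then obtain v where v: "v \<in> V" "f v = s"
    using f unfolding rel_iso_on_def bij_betw_def by (metis imageE)
  show ?thesis
  \<comment> \<open>Every vertex of \<open>W\<close> outside \<open>S\<close> has trace
    \<open>T\<close> on \<open>S\<close>, so it is adjacent to \<open>s\<close> exactly if
    \<open>s\<close> is in \<open>T\<close>. The exceptions lie in the finite set
    \<open>S\<close>.\<close>
  proof (cases "s \<in> T")
    case True
    then have "{z \<in> W - W'. \<not> E s z} \<subseteq> S"
      unfolding W_def by blast
    then have "countable {z \<in> W - W'. \<not> E s z}"
      using S(2) countable_finite finite_subset by blast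
    then have "countable {y \<in> V. \<not> E v y}"
      using rel_iso_on_countable_neighbours_iff[of "\<lambda>x y. \<not> E x y" V "W - W'" f v] f v
      by (simp add: rel_iso_on_not)
    moreover have "symp (\<lambda>x y. \<not> E x y)"
      using \<open>symp E\<close> unfolding symp_def by blast
    moreover have "\<exists>W'. finite W' \<and> (\<exists>f. rel_iso_on (\<lambda>x y. \<not> E x y) V (W - W') f)"
      if "W \<subseteq> V" "uncountable W" for W
      using smooth[OF that] unfolding rel_iso_on_not by blast
    \<comment> \<open>Independence for the non-edges is completeness for \<open>E\<close>.\<close>
    ultimately have "pairwise (\<lambda>x y. \<not> \<not> E x y) V"
      using independent_if_countable_neighbours[of "\<lambda>x y. \<not> E x y" V v]
        \<open>uncountable V\<close> v(1) by simp
    then show ?thesis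
      by simp
  next
    case False
    then have "{z \<in> W - W'. E s z} \<subseteq> S"
      using s(1) unfolding W_def by blast
    then have "countable {z \<in> W - W'. E s z}"
      using S(2) countable_finite finite_subset by blast
    then have "countable {y \<in> V. E v y}"
      using rel_iso_on_countable_neighbours_iff[OF f v(1)] v(2) by simp
    moreover have "\<exists>W'. finite W' \<and> (\<exists>f. rel_iso_on E V (W - W') f)"
      if "W \<subseteq> V" "uncountable W" for W
      using smooth[OF that] by blast
    ultimately have "pairwise (\<lambda>x y. \<not> E x y) V"
      using independent_if_countable_neighbours[OF \<open>symp E\<close> \<open>uncountable V\<close> _ v(1)] by simp
    then show ?thesis ..
  qed
qed

lemma uncountable_omega1: "uncountable omega1"
  unfolding uncountable_iff_omega1_ordLeq by (rule card_of_mono1[OF subset_refl])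

theorem fact1p2:
  fixes G :: "nat set graph"
  assumes "simple_graph G"
    and "verts G = omega1"
    and "\<exists>n::nat. smooth |{..<n}| G"
  shows "complete_graph G \<or> empty_graph G"
proof -
  let ?E = "\<lambda>x y. (x, y) \<in> edges G"
  obtain n :: nat where n: "smooth |{..<n}| G"
    using assms(3) by blast
  have G: "edges G \<subseteq> verts G \<times> verts G" "sym (edges G)" "irrefl (edges G)"
    using assms(1) unfolding simple_graph_def by blast+
  have "symp ?E"
    using G(2) by (simp add: symp_def sym_def)
  have "\<exists>W'. finite W' \<and> card W' \<le> n \<and> (\<exists>f. rel_iso_on ?E (verts G) (W - W') f)"
    if W: "W \<subseteq> verts G" "uncountable W" for W
  proof -
    obtain W' where W': "|W'| \<le>o |{..<n}|" and "isomorphic G (induced G (W - W'))"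
      using n W unfolding smooth_def by meson
    moreover have "verts G \<inter> (W - W') = W - W'"
      using W by blast
    ultimately obtain f where f: "bij_betw f (verts G) (W - W')"
      and "\<And>x y. x \<in> verts G \<Longrightarrow> y \<in> verts G \<Longrightarrow> ?E x y \<longleftrightarrow> (f x, f y) \<in> Restr (edges G) (W - W')"
      unfolding isomorphic_def induced_def by auto
    moreover have "f x \<in> W - W'" if "x \<in> verts G" for x
      using f that unfolding bij_betw_def by blast
    ultimately have "rel_iso_on ?E (verts G) (W - W') f"
      unfolding rel_iso_on_def by simp
    then show ?thesis
      using W' unfolding card_of_ordLeq_lessThan by blast
  qed
  then have "pairwise ?E (verts G) \<or> pairwise (\<lambda>x y. \<not> ?E x y) (verts G)"
    using finitely_smooth_cases[OF \<open>symp ?E\<close>] uncountable_omega1 assms(2) by metis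
  then show ?thesis
  proof
    assume "pairwise ?E (verts G)"
    then show ?thesis
      unfolding complete_graph_def pairwise_def by simp
  next
    assume *: "pairwise (\<lambda>x y. \<not> ?E x y) (verts G)"
    \<comment> \<open>\<open>pairwise\<close> only concerns distinct vertices; simplicity of
      \<open>G\<close> excludes loops and edges leaving \<open>verts G\<close>.\<close>
    have "\<not> ?E x y" for x y
    proof
      assume "?E x y"
      moreover from this have "x \<in> verts G" "y \<in> verts G" "x \<noteq> y"
        using G(1,3) unfolding irrefl_def by auto
      ultimately show False
        using pairwiseD[OF *] by simp
    qed
    then show ?thesis
      unfolding empty_graph_def by auto
  qed
qed

end
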